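(* For every integer $n \geq 2$ there exists a $C^1$ endomorphism $F:\mathbb{T}^n\to\mathbb{T}^n$ of the $n$-dimensional torus that is persistently singular and $C^1$ robustly transitive.
   Context: An endomorphism of $\mathbb{T}^n$ is a differentiable map $\mathbb{T}^n\to\mathbb{T}^n$, not necessarily invertible. A map $h$ is transitive if there is a point $x$ whose forward orbit $\{h^k(x): k\in\mathbb{N}\}$ is dense. A map $h$ is $C^1$ robustly transitive if there is a neighborhood $\mathcal{U}_h$ of $h$ in the $C^1$ topology such that every $g\in\mathcal{U}_h$ is transitive. A critical point of $h$ is a point $x$ at which the differential $D_xh$ is not surjective; $S_h$ denotes the set of critical points of $h$. The map $h$ is persistently singular if there is a neighborhood $\mathcal{U}_h$ of $h$ in the $C^1$ topology such that $S_g\neq\emptyset$ for every $g\in\mathcal{U}_h$. *)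

theory Defs
  imports "HOL-Analysis.Analysis"
begin

section \<open>The torus as the quotient of Euclidean space by the integer lattice\<close>

definition lattice_rel :: "real ^ 'n \<Rightarrow> real ^ 'n \<Rightarrow> bool" where
  "lattice_rel x y \<longleftrightarrow> (\<forall>i. x $ i - y $ i \<in> \<int>)"

lemma equivp_lattice_rel: "equivp lattice_rel"
proof (rule equivpI)
  show "reflp lattice_rel" by (simp add: reflp_def lattice_rel_def)
  show "symp lattice_rel"
    unfolding symp_def lattice_rel_def by (metis Ints_minus minus_diff_eq)
  show "transp lattice_rel"
    unfolding transp_def lattice_rel_def
  proof (intro allI impI)
    fix x y z :: "real ^ 'n" and i
    assume "\<forall>i. x $ i - y $ i \<in> \<int>" "\<forall>i. y $ i - z $ i \<in> \<int>"
    then have "(x $ i - y $ i) + (y $ i - z $ i) \<in> \<int>" by (intro Ints_add) auto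
    then show "x $ i - z $ i \<in> \<int>" by simp
  qed
qed

quotient_type 'n torus = "real ^ 'n" / lattice_rel
  morphisms rep_torus proj
  by (rule equivp_lattice_rel)

lemma proj_eq_iff: "proj x = proj y \<longleftrightarrow> (\<forall>i. x $ i - y $ i \<in> \<int>)"
  using torus.abs_eq_iff[of x y] by (simp add: lattice_rel_def)

lemma proj_translate: "proj x = proj x' \<Longrightarrow> proj (y + (x - x')) = proj y"
  by (simp add: proj_eq_iff)

lemma proj_surj: "\<exists>x. p = proj x"
  using Quotient3_abs_rep[OF Quotient3_torus] by metis

text \<open>The quotient metric: the distance of the two fibres over the given points.\<close>

instantiation torus :: (finite) metric_space
begin

definition dist_torus :: "'a torus \<Rightarrow> 'a torus \<Rightarrow> real" where
  "dist_torus p q = setdist {x. proj x = p} {y. proj y = q}"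

definition uniformity_torus :: "('a torus \<times> 'a torus) filter" where
  "uniformity_torus = (INF e\<in>{0<..}. principal {(x, y). dist x y < e})"

definition open_torus :: "'a torus set \<Rightarrow> bool" where
  "open_torus U \<longleftrightarrow> (\<forall>x\<in>U. \<forall>\<^sub>F (x', y) in uniformity. x' = x \<longrightarrow> y \<in> U)"

lemma fibre_nonempty: "{x. proj x = (p :: 'a torus)} \<noteq> {}"
  using proj_surj[of p] by auto

lemma dist_torus_le: "dist (proj x) (proj y :: 'a torus) \<le> dist x y"
  unfolding dist_torus_def by (rule setdist_le_dist) auto

lemma dist_torus_ltE:
  assumes "dist p q < e" and x: "proj x = (p :: 'a torus)"
  obtains y where "proj y = q" "dist x y < e"
proof -
  obtain x' y' where xy: "proj x' = p" "proj y' = q" "dist x' y' < e"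
    using assms(1) fibre_nonempty[of p] fibre_nonempty[of q]
    unfolding dist_torus_def by (auto elim!: setdist_ltE)
  have "proj (y' + (x - x')) = proj y'"
    using x xy(1) by (intro proj_translate) simp
  moreover have "dist x (y' + (x - x')) = dist x' y'"
    by (simp add: dist_norm)
  ultimately show thesis using that xy by metis
qed

instance
proof
  fix p q r :: "'a torus"
  show "uniformity = (INF e\<in>{0<..}. principal {(x :: 'a torus, y). dist x y < e})"
    by (rule uniformity_torus_def)
  show "open U \<longleftrightarrow> (\<forall>x\<in>U. \<forall>\<^sub>F (x', y) in uniformity. x' = x \<longrightarrow> y \<in> U)"
    for U :: "'a torus set" by (rule open_torus_def)
  have comm: "dist p q = dist q p" for p q :: "'a torus"
    unfolding dist_torus_def by (rule setdist_sym)
  show "dist p q = 0 \<longleftrightarrow> p = q"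
  proof
    assume "p = q" then show "dist p q = 0" by (simp add: dist_torus_def setdist_refl)
  next
    assume d0: "dist p q = 0"
    obtain x where x: "proj x = p" using proj_surj by metis
    obtain y where y: "proj y = q" using proj_surj by metis
    have "x $ i - y $ i \<in> \<int>" for i
    proof (rule ccontr)
      let ?c = "x $ i - y $ i"
      assume "?c \<notin> \<int>"
      have "closed (\<int> :: real set)" by (rule closed_Ints)
      then obtain e where e: "e > 0" "\<And>k. k \<in> \<int> \<Longrightarrow> dist k ?c \<ge> e"
        using \<open>?c \<notin> \<int>\<close> unfolding closed_def open_dist by (force simp: not_less)
      obtain y' where y': "proj y' = q" "dist x y' < e"
        using dist_torus_ltE[of p q e x] d0 e(1) x by metis
      have "y' $ i - y $ i \<in> \<int>" using y y'(1) proj_eq_iff by metis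
      then have "e \<le> dist (y' $ i) (x $ i)"
        using e(2) by (fastforce simp: dist_real_def)
      also have "\<dots> \<le> dist x y'" by (metis dist_commute dist_vec_nth_le)
      finally show False using y' by simp
    qed
    then show "p = q" using x y proj_eq_iff by metis
  qed
  show "dist p q \<le> dist p r + dist q r"
  proof (rule field_le_epsilon)
    fix e :: real assume e: "0 < e"
    obtain x where x: "proj x = p" using proj_surj by metis
    obtain z where z: "proj z = r" "dist x z < dist p r + e/2"
      using dist_torus_ltE[of p r "dist p r + e/2" x] e x by auto
    obtain y where y: "proj y = q" "dist z y < dist r q + e/2"
      using dist_torus_ltE[of r q "dist r q + e/2" z] e z by auto
    have "dist p q \<le> dist x y" using x y dist_torus_le by metis
    also have "\<dots> \<le> dist x z + dist z y" by (rule dist_triangle)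
    finally show "dist p q \<le> dist p r + dist q r + e"
      using z y comm[of q r] by simp
  qed
qed

end

lemma continuous_on_proj: "continuous_on S proj"
  unfolding continuous_on_iff using dist_torus_le by (meson order.strict_trans1)

lemma compact_UNIV_torus: "compact (UNIV :: 'n::finite torus set)"
proof -
  have "p \<in> proj ` cbox 0 1" for p :: "'n torus"
  proof -
    obtain x where x: "p = proj x" using proj_surj by metis
    have "proj (\<chi> i. frac (x $ i)) = proj x"
      by (simp add: proj_eq_iff frac_def)
    moreover have "(\<chi> i. frac (x $ i)) \<in> cbox 0 (1 :: real ^ 'n)"
      by (auto simp: mem_box_cart frac_lt_1 less_imp_le)
    ultimately show ?thesis using x by (metis imageI)
  qed
  then have "(UNIV :: 'n torus set) = proj ` cbox 0 1" by auto
  then show ?thesis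
    by (metis compact_cbox compact_continuous_image continuous_on_proj)
qed

text \<open>The metric induces the quotient topology.\<close>

lemma open_torus_iff: "open U \<longleftrightarrow> open (proj -` (U :: 'n::finite torus set))"
proof
  assume "open U" then show "open (proj -` U)"
    by (rule open_vimage[OF _ continuous_on_proj])
next
  assume o: "open (proj -` U)"
  show "open U" unfolding open_dist
  proof
    fix p assume "p \<in> U"
    obtain x where x: "proj x = p" using proj_surj by metis
    then obtain e where e: "e > 0" "\<And>y. dist y x < e \<Longrightarrow> y \<in> proj -` U"
      using o \<open>p \<in> U\<close> unfolding open_dist by (metis vimageI)
    have "q \<in> U" if "dist q p < e" for q
      using dist_torus_ltE[of p q e x] that e(2) x by (metis dist_commute vimageD)
    then show "\<exists>e>0. \<forall>y. dist y p < e \<longrightarrow> y \<in> U" using e(1) by blast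
  qed
qed

section \<open>Differential calculus on the torus\<close>

text \<open>
  The inverses of the restrictions of \<open>proj\<close> to small balls are the charts of the torus; they
  identify every tangent space with \<open>real ^ 'n\<close>.  So \<open>A\<close> is the differential of \<open>f\<close> at \<open>p\<close> if it
  is the derivative, at a point over \<open>p\<close>, of a map \<open>G\<close> representing \<open>f\<close> in charts there.
\<close>

definition has_torus_derivative ::
  "('n::finite torus \<Rightarrow> 'n torus) \<Rightarrow> ((real ^ 'n) \<Rightarrow>\<^sub>L (real ^ 'n)) \<Rightarrow> 'n torus \<Rightarrow> bool" where
  "has_torus_derivative f A p \<longleftrightarrow>
    (\<exists>x G. p = proj x \<and> (G has_derivative blinfun_apply A) (at x) \<and>
      (\<forall>\<^sub>F y in nhds x. f (proj y) = proj (G y)))"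

definition torus_differential ::
  "('n::finite torus \<Rightarrow> 'n torus) \<Rightarrow> 'n torus \<Rightarrow> ((real ^ 'n) \<Rightarrow>\<^sub>L (real ^ 'n))" where
  "torus_differential f p = (THE A. has_torus_derivative f A p)"

definition C1_endomorphism :: "('n::finite torus \<Rightarrow> 'n torus) \<Rightarrow> bool" where
  "C1_endomorphism f \<longleftrightarrow>
    (\<forall>p. \<exists>A. has_torus_derivative f A p) \<and> continuous_on UNIV (torus_differential f)"

lemma has_torus_derivative_at:
  assumes "has_torus_derivative f A (proj x)"
  obtains G where "(G has_derivative blinfun_apply A) (at x)"
    "\<forall>\<^sub>F y in nhds x. f (proj y) = proj (G y)"
proof -
  obtain x' G where x': "proj x = proj x'" and G: "(G has_derivative blinfun_apply A) (at x')"
    and ev: "\<forall>\<^sub>F y in nhds x'. f (proj y) = proj (G y)"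
    using assms unfolding has_torus_derivative_def by blast
  let ?t = "\<lambda>y. y + (x' - x)"
  have t: "?t x = x'" by simp
  have per: "proj (?t y) = proj y" for y
    using x' by (intro proj_translate) simp
  have "(?t has_derivative (\<lambda>h. h)) (at x)" by (auto intro!: derivative_eq_intros)
  then have "((\<lambda>y. G (?t y)) has_derivative blinfun_apply A) (at x)"
    using has_derivative_compose[of ?t "\<lambda>h. h" x UNIV G] G t by simp
  moreover have "filterlim ?t (nhds x') (nhds x)"
    by (rule tendsto_eq_intros filterlim_ident | simp)+
  then have "\<forall>\<^sub>F y in nhds x. f (proj (?t y)) = proj (G (?t y))"
    by (rule eventually_compose_filterlim[OF ev])
  then have "\<forall>\<^sub>F y in nhds x. f (proj y) = proj (G (?t y))" by (simp only: per)
  ultimately show thesis using that by blast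
qed

lemma has_torus_derivative_unique:
  assumes "has_torus_derivative f A p" "has_torus_derivative f B p"
  shows "A = B"
proof -
  obtain x where x: "p = proj x" using proj_surj by metis
  obtain G where G: "(G has_derivative blinfun_apply A) (at x)"
    and evG: "\<forall>\<^sub>F y in nhds x. f (proj y) = proj (G y)"
    using assms(1) x has_torus_derivative_at by blast
  obtain H where H: "(H has_derivative blinfun_apply B) (at x)"
    and evH: "\<forall>\<^sub>F y in nhds x. f (proj y) = proj (H y)"
    using assms(2) x has_torus_derivative_at by blast
  define D where "D = (\<lambda>y. G y - H y)"
  have D: "(D has_derivative (\<lambda>h. A h - B h)) (at x)"
    unfolding D_def by (intro has_derivative_diff G H)
  have int: "\<forall>\<^sub>F y in nhds x. \<forall>i. D y $ i \<in> \<int>"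
    using evG evH by eventually_elim (simp add: D_def flip: proj_eq_iff)
  have int0: "\<forall>i. D x $ i \<in> \<int>" using eventually_nhds_x_imp_x[OF int] .
  have "isCont D x" using D has_derivative_continuous by blast
  then have "(D \<longlongrightarrow> D x) (nhds x)" by (metis isCont_def tendsto_at_iff_tendsto_nhds)
  then have "\<forall>\<^sub>F y in nhds x. dist (D y) (D x) < 1" by (simp add: tendstoD)
  then have "\<forall>\<^sub>F y in nhds x. D y = D x"
    using int
  proof eventually_elim
    case (elim y)
    have "D y $ i = D x $ i" for i
    proof -
      have "\<bar>D y $ i - D x $ i\<bar> < 1"
        using dist_vec_nth_le[of "D y" i "D x"] elim(1) by (simp add: dist_real_def)
      then show ?thesis using int0 elim(2) Ints_eq_abs_less1 by blast
    qed
    then show ?case by (simp add: vec_eq_iff)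
  qed
  then have "((\<lambda>_. D x) has_derivative (\<lambda>h. A h - B h)) (at x)"
    using D has_derivative_transform_eventually[OF D, of "\<lambda>_. D x"]
    by (auto simp: eventually_nhds_conv_at)
  then have "(\<lambda>h. A h - B h) = (\<lambda>h. 0)"
    using has_derivative_unique has_derivative_const by blast
  then show ?thesis by (metis blinfun_eqI eq_iff_diff_eq_0)
qed

lemma torus_differential_eq: "has_torus_derivative f A p \<Longrightarrow> torus_differential f p = A"
  unfolding torus_differential_def using has_torus_derivative_unique by blast

lemma has_torus_derivative_isCont:
  assumes "has_torus_derivative f A p" shows "isCont f p"
proof -
  obtain x where x: "p = proj x" using proj_surj by metis
  obtain G where G: "(G has_derivative blinfun_apply A) (at x)"
    and ev: "\<forall>\<^sub>F y in nhds x. f (proj y) = proj (G y)"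
    using assms x has_torus_derivative_at by blast
  have fx: "f p = proj (G x)" using eventually_nhds_x_imp_x[OF ev] x by simp
  have "isCont G x" using G has_derivative_continuous by blast
  then have lim: "(G \<longlongrightarrow> G x) (nhds x)"
    by (metis isCont_def tendsto_at_iff_tendsto_nhds)
  show ?thesis unfolding continuous_at_eps_delta
  proof (intro allI impI)
    fix e :: real assume "0 < e"
    then have "\<forall>\<^sub>F y in nhds x. dist (G y) (G x) < e" using lim by (simp add: tendstoD)
    with ev have "\<forall>\<^sub>F y in nhds x. dist (f (proj y)) (f p) < e"
      by eventually_elim (metis dist_torus_le fx order.strict_trans1)
    then obtain d where d: "d > 0" "\<And>y. dist y x < d \<Longrightarrow> dist (f (proj y)) (f p) < e"
      unfolding eventually_nhds_metric by blast
    have "dist (f q) (f p) < e" if "dist q p < d" for q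
      using dist_torus_ltE[of p q d x] that d(2) x by (metis dist_commute)
    then show "\<exists>d>0. \<forall>q. dist q p < d \<longrightarrow> dist (f q) (f p) < e" using d(1) by blast
  qed
qed

lemma C1_endomorphism_continuous: "C1_endomorphism f \<Longrightarrow> continuous_on UNIV f"
  unfolding C1_endomorphism_def
  by (metis continuous_at_imp_continuous_on has_torus_derivative_isCont)

section \<open>The \<open>C\<^sup>1\<close> topology\<close>

text \<open>
  The value outside the \<open>C\<^sup>1\<close> endomorphisms is irrelevant for the topology below; it is fixed
  because the locale \<open>Metric_space\<close> requires nonnegativity everywhere.
\<close>

definition C1_dist :: "('n::finite torus \<Rightarrow> 'n torus) \<Rightarrow> ('n torus \<Rightarrow> 'n torus) \<Rightarrow> real" where
  "C1_dist f g =
    (if C1_endomorphism f \<and> C1_endomorphism g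
     then (SUP p. dist (f p) (g p))
        + (SUP p. norm (torus_differential f p - torus_differential g p))
     else 0)"

lemma C1_bdd:
  assumes "C1_endomorphism f" "C1_endomorphism g"
  shows "bdd_above (range (\<lambda>p. dist (f p) (g p)))"
    and "bdd_above (range (\<lambda>p. norm (torus_differential f p - torus_differential g p)))"
proof -
  have "continuous_on UNIV (\<lambda>p. dist (f p) (g p))"
    using assms by (intro continuous_intros C1_endomorphism_continuous)
  then show "bdd_above (range (\<lambda>p. dist (f p) (g p)))"
    by (intro bounded_imp_bdd_above compact_imp_bounded compact_continuous_image compact_UNIV_torus)
  have "continuous_on UNIV (\<lambda>p. norm (torus_differential f p - torus_differential g p))"
    using assms unfolding C1_endomorphism_def by (intro continuous_intros) auto
  then show "bdd_above (range (\<lambda>p. norm (torus_differential f p - torus_differential g p)))"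
    by (intro bounded_imp_bdd_above compact_imp_bounded compact_continuous_image compact_UNIV_torus)
qed

lemma Metric_space_C1: "Metric_space (Collect C1_endomorphism) C1_dist"
proof
  fix f g h :: "'n::finite torus \<Rightarrow> 'n torus"
  let ?D = torus_differential
  have ub: "dist (f p) (g p) \<le> (SUP p. dist (f p) (g p))"
    "norm (?D f p - ?D g p) \<le> (SUP p. norm (?D f p - ?D g p))"
    if "C1_endomorphism f" "C1_endomorphism g" for f g :: "'n torus \<Rightarrow> 'n torus" and p
    using C1_bdd[OF that] by (auto intro: cSUP_upper)
  have nn: "0 \<le> (SUP p. dist (f p) (g p))" "0 \<le> (SUP p. norm (?D f p - ?D g p))"
    if "C1_endomorphism f" "C1_endomorphism g" for f g :: "'n torus \<Rightarrow> 'n torus"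
    using ub[OF that] by (meson zero_le_dist norm_ge_zero order.trans)+
  show "0 \<le> C1_dist f g" using nn by (simp add: C1_dist_def)
  show "C1_dist f g = C1_dist g f"
    by (simp add: C1_dist_def dist_commute norm_minus_commute)
  show "C1_dist f g = 0 \<longleftrightarrow> f = g"
    if "f \<in> Collect C1_endomorphism" "g \<in> Collect C1_endomorphism"
  proof
    assume "C1_dist f g = 0"
    then have "(SUP p. dist (f p) (g p)) = 0"
      using that nn[of f g] by (simp add: C1_dist_def add_nonneg_eq_0_iff)
    then show "f = g" using ub(1)[of f g] that by fastforce
  qed (simp add: C1_dist_def)
  show "C1_dist f h \<le> C1_dist f g + C1_dist g h"
    if "f \<in> Collect C1_endomorphism" "g \<in> Collect C1_endomorphism" "h \<in> Collect C1_endomorphism"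
  proof -
    have C: "C1_endomorphism f" "C1_endomorphism g" "C1_endomorphism h" using that by auto
    have "(SUP p. dist (f p) (h p)) \<le> (SUP p. dist (f p) (g p)) + (SUP p. dist (g p) (h p))"
    proof (rule cSUP_least)
      fix p show "dist (f p) (h p) \<le> (SUP p. dist (f p) (g p)) + (SUP p. dist (g p) (h p))"
        using ub(1)[OF C(1,2), of p] ub(1)[OF C(2,3), of p] dist_triangle[of "f p" "h p" "g p"]
        by linarith
    qed simp
    moreover have "(SUP p. norm (?D f p - ?D h p))
        \<le> (SUP p. norm (?D f p - ?D g p)) + (SUP p. norm (?D g p - ?D h p))"
    proof (rule cSUP_least)
      fix p show "norm (?D f p - ?D h p)
          \<le> (SUP p. norm (?D f p - ?D g p)) + (SUP p. norm (?D g p - ?D h p))"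
        using ub(2)[OF C(1,2), of p] ub(2)[OF C(2,3), of p]
          norm_triangle_ineq[of "?D f p - ?D g p" "?D g p - ?D h p"]
        by simp
    qed simp
    ultimately show ?thesis using C by (simp add: C1_dist_def)
  qed
qed

definition C1_topology :: "('n::finite torus \<Rightarrow> 'n torus) topology" where
  "C1_topology = Metric_space.mtopology (Collect C1_endomorphism) C1_dist"

lemma topspace_C1_topology: "topspace C1_topology = Collect C1_endomorphism"
  unfolding C1_topology_def by (rule Metric_space.topspace_mtopology[OF Metric_space_C1])

section \<open>Transitivity and critical points\<close>

definition transitive_map :: "('a::topological_space \<Rightarrow> 'a) \<Rightarrow> bool" where
  "transitive_map h \<longleftrightarrow> (\<exists>x. closure {(h ^^ k) x |k::nat. True} = UNIV)"

definition C1_robustly_transitive :: "('n::finite torus \<Rightarrow> 'n torus) \<Rightarrow> bool" where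
  "C1_robustly_transitive h \<longleftrightarrow>
    (\<exists>U. openin C1_topology U \<and> h \<in> U \<and> (\<forall>g\<in>U. transitive_map g))"

definition critical_points :: "('n::finite torus \<Rightarrow> 'n torus) \<Rightarrow> 'n torus set" where
  "critical_points h = {p. \<not> surj (blinfun_apply (torus_differential h p))}"

definition persistently_singular :: "('n::finite torus \<Rightarrow> 'n torus) \<Rightarrow> bool" where
  "persistently_singular h \<longleftrightarrow>
    (\<exists>U. openin C1_topology U \<and> h \<in> U \<and> (\<forall>g\<in>U. critical_points g \<noteq> {}))"

end

theory Submission
  imports Defs
begin

text \<open>
  The example is a skew product over an expanding circle map with contracting fibre maps.  One
  coordinate \<open>b\<close> is the base; let \<open>N\<close> be the dimension and \<open>e\<close> an enumeration of the coordinates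
  by \<open>0, \<dots>, N - 1\<close>.  The map sends \<open>x\<close> to the point with base coordinate \<open>64^N * x_b\<close> and with
  fibre coordinates \<open>64^(e j) * x_b + sin (2 * pi * x_j) / (8 * pi)\<close>.

  The differential in the direction of the fibre coordinate \<open>j\<close> is multiplication by
  \<open>cos (2 * pi * x_j) / 4\<close>.  Hence the Jacobian determinant changes sign, and so does that of every
  \<open>C\<^sup>1\<close>-close map, which therefore has a critical point.

  For robust transitivity, lift a \<open>C\<^sup>1\<close>-close map \<open>f\<close> to a map \<open>G\<close> of Euclidean space; it differs from
  the lift of the model by a function that is small and has a small Lipschitz constant
  (\<open>perturbed_model_if_close\<close>), and only this is used.  The argument rests on three facts, none of
  which needs an invertible derivative.

    \<^item> A cone around the base direction is forward invariant, and the base component of a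
      difference in the cone is at least doubled (\<open>cone_step\<close>).
    \<^item> If two orbits have equal base coordinates at time \<open>m\<close>, then their difference was never in the
      wide cone before (unless it vanished), and so its fibre part was contracted by \<open>3 / 4\<close> at every
      step (\<open>vert_pow_contraction\<close>).
    \<^item> The perturbed map is still onto (\<open>surj_f\<close>): the shears by powers of 64 let a preimage be chosen
      by its base-64 digits so that only a small correction in the fibres remains, which the
      sine, having slope \<open>1 / 4\<close> at the origin, can make; Brouwer's theorem absorbs the perturbation.

  Given a point \<open>u\<close> and a target \<open>q\<close>, choose \<open>w\<close> with \<open>f^l (proj w) = q\<close>, moved by integers to
  within a bounded distance of \<open>G^k u\<close>.
  The image under \<open>G^(k + l)\<close> of the line through \<open>u\<close> in the base direction contains a point whose base
  coordinate is that of \<open>G^l w\<close>.  By contraction this point is close to \<open>G^l w\<close>, hence over a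
  neighbourhood of \<open>q\<close>; by expansion it comes from a point of the line close to \<open>u\<close>
  (\<open>orbit_from_ball_to_ball\<close>).  Baire's theorem then yields a dense orbit.
\<close>

section \<open>The model map\<close>

lemma abs_sin_diff_le: "\<bar>sin s - sin t\<bar> \<le> \<bar>s - t\<bar>" for s t :: real
proof -
  have "\<bar>sin s - sin t\<bar> = 2 * (\<bar>sin ((s - t) / 2)\<bar> * \<bar>cos ((s + t) / 2)\<bar>)"
    by (simp add: sin_diff_sin abs_mult)
  also have "\<dots> \<le> 2 * (\<bar>(s - t) / 2\<bar> * 1)"
    by (intro mult_left_mono mult_mono abs_sin_x_le_abs_x) auto
  finally show ?thesis by simp
qed

text \<open>
  A real number \<open>x\<close> can be chosen so that its iterates under multiplication by 64 follow a
  prescribed sequence modulo 1 with error \<open>1 / 64\<close>, the last one exactly.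
\<close>

lemma digits:
  fixes w :: "nat \<Rightarrow> real"
  shows "\<exists>x. 64 ^ N * x - w N \<in> \<int> \<and> (\<forall>i<N. \<exists>z\<in>\<int>. \<bar>64 ^ i * x - w i - z\<bar> \<le> 1 / 64)"
proof (induction N arbitrary: w)
  case 0
  show ?case by (rule exI[of _ "w 0"]) simp
next
  case (Suc N)
  obtain y where y: "64 ^ N * y - w (Suc N) \<in> \<int>"
    "\<And>i. i < N \<Longrightarrow> \<exists>z\<in>\<int>. \<bar>64 ^ i * y - w (Suc i) - z\<bar> \<le> 1 / 64"
    using Suc[of "\<lambda>i. w (Suc i)"] by auto
  define k where "k = \<lfloor>64 * w 0 - y\<rfloor>"
  define x where "x = (y + of_int k) / 64"
  have shift: "64 ^ Suc i * x = 64 ^ i * y + 64 ^ i * of_int k" for i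
    by (simp add: x_def field_simps)
  have "64 ^ Suc N * x - w (Suc N) = (64 ^ N * y - w (Suc N)) + of_int (64 ^ N * k)"
    by (simp only: shift) simp
  then have "64 ^ Suc N * x - w (Suc N) \<in> \<int>"
    using y(1) by (metis Ints_add Ints_of_int)
  moreover have "\<exists>z\<in>\<int>. \<bar>64 ^ i * x - w i - z\<bar> \<le> 1 / 64" if i: "i < Suc N" for i
  proof (cases i)
    case 0
    have "of_int k \<le> 64 * w 0 - y" "64 * w 0 - y < of_int k + 1"
      unfolding k_def by linarith+
    moreover have "64 * x = y + of_int k" by (simp add: x_def)
    ultimately have "\<bar>x - w 0\<bar> \<le> 1 / 64" by linarith
    then have "\<bar>64 ^ i * x - w i - 0\<bar> \<le> 1 / 64" by (simp add: 0)
    then show ?thesis using Ints_0 by blast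
  next
    case (Suc j)
    then obtain z where z: "z \<in> \<int>" "\<bar>64 ^ j * y - w i - z\<bar> \<le> 1 / 64"
      using y(2)[of j] i by auto
    have "64 ^ i * x - w i - (z + of_int (64 ^ j * k)) = 64 ^ j * y - w i - z"
      by (simp only: Suc shift) simp
    moreover have "z + of_int (64 ^ j * k) \<in> \<int>" using z(1) by (intro Ints_add) auto
    ultimately show ?thesis using z(2) by metis
  qed
  ultimately show ?case by blast
qed

text \<open>
  The base coordinate \<open>b\<close> and an enumeration \<open>e\<close> of all coordinates, which fixes the powers of 64 in
  the shears.
\<close>

locale skew_model =
  fixes b :: "'n::finite" and e :: "'n \<Rightarrow> nat"
  assumes card_ge_2: "CARD('n) \<ge> 2"
    and bij_e: "bij_betw e UNIV {..<CARD('n)}"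
begin

text \<open>The model map on Euclidean space, the universal cover of the torus.\<close>

definition lift :: "real ^ 'n \<Rightarrow> real ^ 'n" where
  "lift x = (\<chi> i. if i = b then 64 ^ CARD('n) * x $ b
                  else 64 ^ e i * x $ b + sin (2 * pi * x $ i) / (8 * pi))"

text \<open>
  The size of the fibre part of a vector.  The sum norm, rather than the Euclidean norm, lets the
  estimates be made one coordinate at a time.
\<close>

definition vert :: "real ^ 'n \<Rightarrow> real" where
  "vert d = (\<Sum>j\<in>-{b}. \<bar>d $ j\<bar>)"

text \<open>
  The size of the fibre part of the image of the unit base vector under the derivative of \<open>lift\<close>.
\<close>

definition shear :: real where
  "shear = (\<Sum>j\<in>-{b}. 64 ^ e j)"

text \<open>
  The \<open>C\<^sup>1\<close> size of the admitted perturbations.  The factor \<open>shear\<close> in the denominator is needed for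
  vectors in the wide cone, whose fibre part may be \<open>4 * shear\<close> times their base component.
\<close>

definition tol :: real where
  "tol = 1 / (128 * CARD('n) * shear)"

lemma lift_base: "lift x $ b = 64 ^ CARD('n) * x $ b"
  by (simp add: lift_def)

lemma lift_fibre: "j \<noteq> b \<Longrightarrow> lift x $ j = 64 ^ e j * x $ b + sin (2 * pi * x $ j) / (8 * pi)"
  by (simp add: lift_def)

lemma ex_fibre_index: "\<exists>c. c \<noteq> b"
proof (rule ccontr)
  assume "\<nexists>c. c \<noteq> b"
  then have "(UNIV :: 'n set) = {b}" by auto
  then have "CARD('n) = 1" by (metis card_1_singleton_iff One_nat_def)
  then show False using card_ge_2 by simp
qed

lemma e_less: "e j < CARD('n)"
  using bij_e by (auto simp: bij_betw_def)

lemma shear_ge_1: "shear \<ge> 1"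
proof -
  obtain c where c: "c \<noteq> b" using ex_fibre_index by blast
  have "(1::real) \<le> 64 ^ e c" by simp
  also have "\<dots> \<le> shear"
    unfolding shear_def by (rule member_le_sum) (use c in auto)
  finally show ?thesis .
qed

lemma shear_le: "shear + 2 \<le> 64 ^ CARD('n)"
proof -
  have "shear \<le> (\<Sum>j\<in>UNIV. 64 ^ e j)"
    unfolding shear_def by (rule sum_mono2) auto
  also have "\<dots> = (\<Sum>i<CARD('n). 64 ^ i)"
    using sum.reindex_bij_betw[OF bij_e, of "\<lambda>i. 64 ^ i :: real"] .
  also have "\<dots> = (64 ^ CARD('n) - 1) / 63"
    by (simp add: geometric_sum)
  finally have "63 * shear \<le> 64 ^ CARD('n) - 1" by simp
  then show ?thesis using shear_ge_1 by linarith
qed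

lemma vert_nonneg: "vert d \<ge> 0"
  by (simp add: vert_def sum_nonneg)

lemma vert_minus: "vert (- d) = vert d"
  by (simp add: vert_def)

lemma vert_triangle: "vert (c + d) \<le> vert c + vert d"
  unfolding vert_def by (simp add: sum.distrib[symmetric] sum_mono abs_triangle_ineq)

lemma norm_le_base_vert: "norm d \<le> \<bar>d $ b\<bar> + vert d"
proof -
  have "norm d \<le> (\<Sum>i\<in>UNIV. \<bar>d $ i\<bar>)" by (rule norm_le_l1_cart)
  also have "\<dots> = \<bar>d $ b\<bar> + vert d"
    unfolding vert_def Compl_eq_Diff_UNIV by (rule sum.remove) auto
  finally show ?thesis .
qed

lemma tol_pos: "tol > 0"
  using shear_ge_1 by (simp add: tol_def)

lemma card_tol: "CARD('n) * tol * shear = 1 / 128"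
  using shear_ge_1 by (simp add: tol_def)

lemma card_tol_le: "CARD('n) * tol \<le> 1 / 128"
proof -
  have "CARD('n) * tol * 1 \<le> CARD('n) * tol * shear"
    using shear_ge_1 tol_pos by (intro mult_left_mono) auto
  then show ?thesis using card_tol by simp
qed

lemma tol_le_card_tol: "tol \<le> CARD('n) * tol"
  using tol_pos card_ge_2 by simp

lemma proj_lift_cong:
  assumes "proj x = proj y" shows "proj (lift x) = proj (lift y)"
proof -
  have int: "x $ i - y $ i \<in> \<int>" for i using assms proj_eq_iff by metis
  have "lift x $ i - lift y $ i \<in> \<int>" for i
  proof (cases "i = b")
    case True
    have "lift x $ i - lift y $ i = 64 ^ CARD('n) * (x $ b - y $ b)"
      by (simp add: True lift_base algebra_simps)
    then show ?thesis using int[of b] by (metis Ints_mult Ints_power Ints_numeral)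
  next
    case False
    obtain k where k: "x $ i = y $ i + of_int k"
      using int[of i] by (metis Ints_cases add.commute diff_add_cancel)
    have "sin (2 * pi * x $ i) = sin (2 * pi * y $ i + (2 * pi) * of_int k)"
      by (simp add: k algebra_simps)
    also have "\<dots> = sin (2 * pi * y $ i)"
      unfolding sin_add sin_int_2pin cos_int_2pin by simp
    finally have "lift x $ i - lift y $ i = 64 ^ e i * (x $ b - y $ b)"
      by (simp add: False lift_fibre algebra_simps)
    then show ?thesis using int[of b] by (metis Ints_mult Ints_power Ints_numeral)
  qed
  then show ?thesis by (simp add: proj_eq_iff)
qed

text \<open>The model map of the torus; by \<open>proj_lift_cong\<close> the choice of the representative is irrelevant.\<close>

definition torus_map :: "'n torus \<Rightarrow> 'n torus" where
  "torus_map p = proj (lift (SOME x. proj x = p))"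

lemma torus_map_proj: "torus_map (proj x) = proj (lift x)"
proof -
  have "proj (SOME y. proj y = proj x) = proj x" by (rule someI[of _ x]) simp
  then show ?thesis unfolding torus_map_def by (rule proj_lift_cong)
qed

text \<open>The derivative of \<open>lift\<close> at \<open>x\<close>, applied to \<open>h\<close>.\<close>

definition lift_deriv :: "real ^ 'n \<Rightarrow> real ^ 'n \<Rightarrow> real ^ 'n" where
  "lift_deriv x h = (\<chi> i. if i = b then 64 ^ CARD('n) * h $ b
                          else 64 ^ e i * h $ b + cos (2 * pi * x $ i) / 4 * h $ i)"

lemma lift_has_derivative: "(lift has_derivative lift_deriv x) (at x)"
proof (subst has_derivative_componentwise_within, rule ballI)
  fix v :: "real ^ 'n" assume "v \<in> Basis"
  then obtain i where v: "v = axis i 1" by (auto simp: Basis_vec_def)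
  have comp: "((\<lambda>x :: real ^ 'n. x $ j) has_derivative (\<lambda>h. h $ j)) (at x)" for j
    by (intro bounded_linear_imp_has_derivative bounded_linear_vec_nth)
  show "((\<lambda>x. lift x \<bullet> v) has_derivative (\<lambda>h. lift_deriv x h \<bullet> v)) (at x)"
  proof (cases "i = b")
    case True
    then show ?thesis
      by (auto simp: v lift_def lift_deriv_def inner_axis intro!: derivative_eq_intros comp)
  next
    case False
    then show ?thesis
      by (auto simp: v lift_def lift_deriv_def inner_axis fun_eq_iff field_simps
          intro!: derivative_eq_intros comp)
  qed
qed

lemma bounded_linear_lift_deriv: "bounded_linear (lift_deriv x)"
  using lift_has_derivative has_derivative_bounded_linear by blast

lemma torus_map_has_torus_derivative: "has_torus_derivative torus_map (Blinfun (lift_deriv x)) (proj x)"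
  unfolding has_torus_derivative_def
  using lift_has_derivative[of x]
  by (intro exI[of _ x] exI[of _ lift])
    (simp add: bounded_linear_Blinfun_apply bounded_linear_lift_deriv torus_map_proj)

lemma torus_differential_torus_map: "torus_differential torus_map (proj x) = Blinfun (lift_deriv x)"
  by (rule torus_differential_eq[OF torus_map_has_torus_derivative])

end

lemma continuous_on_torus:
  fixes g :: "'n::finite torus \<Rightarrow> 'b::topological_space"
  assumes "continuous_on UNIV (\<lambda>x. g (proj x))"
  shows "continuous_on UNIV g"
  unfolding continuous_on_open_vimage[OF open_UNIV]
proof (intro allI impI)
  fix B :: "'b set" assume "open B"
  then have "open ((\<lambda>x. g (proj x)) -` B)"
    using assms by (simp add: continuous_on_open_vimage[OF open_UNIV])
  then show "open (g -` B \<inter> UNIV)"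
    by (simp add: open_torus_iff vimage_def)
qed

context skew_model
begin

lemma C1_endomorphism_torus_map: "C1_endomorphism torus_map"
  unfolding C1_endomorphism_def
proof
  show "\<forall>p. \<exists>A. has_torus_derivative torus_map A p"
    using torus_map_has_torus_derivative proj_surj by metis
  show "continuous_on UNIV (torus_differential torus_map)"
  proof (rule continuous_on_torus, unfold torus_differential_torus_map,
      rule continuous_on_blinfun_componentwise)
    fix h :: "real ^ 'n"
    show "continuous_on UNIV (\<lambda>x. blinfun_apply (Blinfun (lift_deriv x)) h)"
      unfolding bounded_linear_Blinfun_apply[OF bounded_linear_lift_deriv] lift_deriv_def
    proof (rule continuous_on_vec_lambda)
      fix i
      show "continuous_on UNIV (\<lambda>x. if i = b then 64 ^ CARD('n) * h $ b
          else 64 ^ e i * h $ b + cos (2 * pi * x $ i) / 4 * h $ i)"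
        by (cases "i = b") (auto intro!: continuous_intros)
    qed
  qed
qed

end


section \<open>Cones, contraction and surjectivity for perturbations\<close>

text \<open>
  A self-map \<open>f\<close> of the torus covered by \<open>lift + E\<close>, where \<open>E\<close> is bounded by \<open>tol\<close> and
  \<open>tol\<close>-Lipschitz.
\<close>

locale perturbed_model = skew_model b e for b :: "'n::finite" and e +
  fixes f :: "'n torus \<Rightarrow> 'n torus" and E :: "real ^ 'n \<Rightarrow> real ^ 'n"
  assumes semiconj: "f (proj x) = proj (lift x + E x)"
    and E_le: "norm (E x) \<le> tol"
    and E_lipschitz: "norm (E x - E y) \<le> tol * norm (x - y)"
begin

text \<open>The lift of the perturbed map \<open>f\<close>.\<close>

definition G :: "real ^ 'n \<Rightarrow> real ^ 'n" where
  "G x = lift x + E x"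

lemma f_proj: "f (proj x) = proj (G x)"
  by (simp add: semiconj G_def)

lemma f_pow_proj: "(f ^^ k) (proj x) = proj ((G ^^ k) x)"
  by (induction k) (simp_all add: f_proj)

lemma E_diff_le: "\<bar>E x $ i - E y $ i\<bar> \<le> tol * (\<bar>(x - y) $ b\<bar> + vert (x - y))"
proof -
  have "\<bar>E x $ i - E y $ i\<bar> \<le> norm (E x - E y)"
    using component_le_norm_cart[of "E x - E y" i] by simp
  also have "\<dots> \<le> tol * norm (x - y)" by (rule E_lipschitz)
  also have "\<dots> \<le> tol * (\<bar>(x - y) $ b\<bar> + vert (x - y))"
    using tol_pos by (intro mult_left_mono norm_le_base_vert) auto
  finally show ?thesis .
qed

lemma G_base_diff:
  "\<bar>(G x - G y) $ b - 64 ^ CARD('n) * (x - y) $ b\<bar> \<le> tol * (\<bar>(x - y) $ b\<bar> + vert (x - y))"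
proof -
  have "(G x - G y) $ b - 64 ^ CARD('n) * (x - y) $ b = E x $ b - E y $ b"
    by (simp add: G_def lift_base algebra_simps)
  then show ?thesis using E_diff_le by simp
qed

lemma G_vert_diff:
  "vert (G x - G y) \<le> shear * \<bar>(x - y) $ b\<bar> + vert (x - y) / 4
      + CARD('n) * tol * (\<bar>(x - y) $ b\<bar> + vert (x - y))"
proof -
  let ?t = "tol * (\<bar>(x - y) $ b\<bar> + vert (x - y))"
  have t: "?t \<ge> 0" using tol_pos vert_nonneg[of "x - y"] by simp
  have "\<bar>(G x - G y) $ j\<bar> \<le> 64 ^ e j * \<bar>(x - y) $ b\<bar> + \<bar>(x - y) $ j\<bar> / 4 + ?t"
    if j: "j \<in> -{b}" for j
  proof -
    let ?s = "sin (2 * pi * x $ j) - sin (2 * pi * y $ j)"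
    have "\<bar>?s\<bar> \<le> \<bar>2 * pi * x $ j - 2 * pi * y $ j\<bar>" by (rule abs_sin_diff_le)
    also have "\<dots> = 2 * pi * \<bar>(x - y) $ j\<bar>"
      by (simp add: abs_mult flip: right_diff_distrib)
    finally have "\<bar>?s\<bar> / (8 * pi) \<le> 2 * pi * \<bar>(x - y) $ j\<bar> / (8 * pi)"
      by (rule divide_right_mono) simp
    also have "\<dots> = \<bar>(x - y) $ j\<bar> / 4" by simp
    finally have s: "\<bar>?s / (8 * pi)\<bar> \<le> \<bar>(x - y) $ j\<bar> / 4"
      by (simp only: abs_divide abs_mult) simp
    have "(G x - G y) $ j = 64 ^ e j * (x - y) $ b + ?s / (8 * pi) + (E x $ j - E y $ j)"
      using j by (simp add: G_def lift_fibre algebra_simps diff_divide_distrib)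
    moreover have "\<bar>64 ^ e j * (x - y) $ b\<bar> = 64 ^ e j * \<bar>(x - y) $ b\<bar>"
      by (simp only: abs_mult) simp
    ultimately show ?thesis using s E_diff_le[of x j y] by linarith
  qed
  then have "vert (G x - G y)
      \<le> (\<Sum>j\<in>-{b}. 64 ^ e j * \<bar>(x - y) $ b\<bar> + \<bar>(x - y) $ j\<bar> / 4 + ?t)"
    unfolding vert_def[of "G x - G y"] by (rule sum_mono)
  also have "\<dots> = shear * \<bar>(x - y) $ b\<bar> + vert (x - y) / 4 + card (-{b}) * ?t"
    by (simp add: sum.distrib shear_def vert_def sum_distrib_right sum_divide_distrib)
  also have "card (-{b}) * ?t \<le> CARD('n) * ?t"
    using t by (intro mult_right_mono) (auto intro: card_mono)
  finally show ?thesis by (simp add: mult.assoc)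
qed

text \<open>
  All cones of aperture \<open>k\<close> between \<open>1\<close> and \<open>4 * shear\<close> are forward invariant.  The narrow one
  (\<open>k = 1\<close>) controls the images of the base line, the wide one bounds the region without
  contraction.
\<close>

lemma cone_step:
  assumes k: "1 \<le> k" "k \<le> 4 * shear" and cone: "vert (x - y) \<le> k * (x - y) $ b"
  shows "2 * (x - y) $ b \<le> (G x - G y) $ b" "vert (G x - G y) \<le> k * (G x - G y) $ b"
proof -
  define d v c where "d = (x - y) $ b" and "v = vert (x - y)" and "c = CARD('n) * tol"
  define M :: real where "M = 64 ^ CARD('n)"
  have c: "0 \<le> c" "c \<le> 1 / 128" "tol \<le> c"
    using tol_pos card_tol_le tol_le_card_tol by (auto simp: c_def)
  have v: "0 \<le> v" "v \<le> k * d" using vert_nonneg cone by (auto simp: v_def d_def)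
  then have d: "0 \<le> d" using k(1) by (metis dual_order.trans not_one_le_zero zero_le_mult_iff)
  have ck: "c * k \<le> 1 / 32"
  proof -
    have "c * k \<le> c * (4 * shear)" using c k by (intro mult_left_mono) auto
    also have "\<dots> = 4 * (CARD('n) * tol * shear)" by (simp add: c_def)
    also have "\<dots> = 1 / 32" by (simp only: card_tol)
    finally show ?thesis .
  qed
  have "c * v \<le> c * (k * d)" using c v by (intro mult_left_mono) auto
  also have "\<dots> \<le> 1 / 32 * d" using ck d by (metis mult.assoc mult_right_mono)
  finally have cv: "c * v \<le> d / 32" by simp
  have cd: "c * d \<le> d / 128" using c d mult_right_mono[of c "1 / 128" d] by simp
  have err: "c * (d + v) \<le> d / 16" using cv cd d by (simp add: algebra_simps)
  have "tol * (d + v) \<le> c * (d + v)" using c d v by (intro mult_right_mono) auto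
  moreover have "\<bar>(G x - G y) $ b - M * d\<bar> \<le> tol * (d + v)"
    using G_base_diff[of x y, folded d_def v_def M_def] d by simp
  ultimately have base: "(G x - G y) $ b \<ge> M * d - d / 16" using err by linarith
  have M: "shear + 2 \<le> M" "3 \<le> M" using shear_le shear_ge_1 by (auto simp: M_def)
  have "3 * d \<le> M * d" using M d by (intro mult_right_mono) auto
  with base d show "2 * (x - y) $ b \<le> (G x - G y) $ b"
    unfolding d_def[symmetric] by linarith
  have "vert (G x - G y) \<le> shear * d + v / 4 + c * (d + v)"
    using G_vert_diff[of x y] d by (simp add: d_def v_def c_def)
  also have "\<dots> \<le> shear * d + k * d / 4 + d / 16" using err v by simp
  also have "\<dots> \<le> k * ((shear + 1) * d + d / 4 + d / 16)"
  proof -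
    have "0 \<le> (k - 1) * (shear * d)" "0 \<le> (k - 1) * d"
      using k d shear_ge_1 by auto
    then show ?thesis using d k by (simp add: algebra_simps)
  qed
  also have "\<dots> \<le> k * (M * d - d / 16)"
  proof (intro mult_left_mono)
    have "(shear + 2) * d \<le> M * d" using M d by (intro mult_right_mono) auto
    then show "(shear + 1) * d + d / 4 + d / 16 \<le> M * d - d / 16"
      using d by (simp add: algebra_simps)
  qed (use k in auto)
  also have "\<dots> \<le> k * (G x - G y) $ b"
    using base k by (intro mult_left_mono) auto
  finally show "vert (G x - G y) \<le> k * (G x - G y) $ b" .
qed

lemma cone_pow:
  assumes "1 \<le> k" "k \<le> 4 * shear" "vert (x - y) \<le> k * (x - y) $ b"
  shows "2 ^ m * (x - y) $ b \<le> ((G ^^ m) x - (G ^^ m) y) $ b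
    \<and> vert ((G ^^ m) x - (G ^^ m) y) \<le> k * ((G ^^ m) x - (G ^^ m) y) $ b"
proof (induction m)
  case 0
  then show ?case using assms by simp
next
  case (Suc m)
  then show ?case
    using cone_step[OF assms(1,2), of "(G ^^ m) x" "(G ^^ m) y"]
    by simp
qed

lemma cone_pow_abs:
  assumes "1 \<le> k" "k \<le> 4 * shear" "vert (x - y) \<le> k * \<bar>(x - y) $ b\<bar>"
  shows "2 ^ m * \<bar>(x - y) $ b\<bar> \<le> \<bar>((G ^^ m) x - (G ^^ m) y) $ b\<bar>"
    and "vert ((G ^^ m) x - (G ^^ m) y) \<le> k * \<bar>((G ^^ m) x - (G ^^ m) y) $ b\<bar>"
proof -
  have vert_swap: "vert (p - q) = vert (q - p)" for p q
    using vert_minus[of "p - q"] by simp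
  have "2 ^ m * \<bar>(x - y) $ b\<bar> \<le> \<bar>((G ^^ m) x - (G ^^ m) y) $ b\<bar>
    \<and> vert ((G ^^ m) x - (G ^^ m) y) \<le> k * \<bar>((G ^^ m) x - (G ^^ m) y) $ b\<bar>"
  proof (cases "(x - y) $ b \<ge> 0")
    case True
    then have "vert (x - y) \<le> k * (x - y) $ b" using assms(3) by simp
    from cone_pow[OF assms(1,2) this, of m] assms(1) True show ?thesis
      by (smt (verit) mult_left_mono)
  next
    case False
    then have "vert (y - x) \<le> k * (y - x) $ b" using assms(3) vert_swap[of x y] by simp
    from cone_pow[OF assms(1,2) this, of m] assms(1) False vert_swap show ?thesis
      by (smt (verit) mult_left_mono vector_minus_component)
  qed
  then show "2 ^ m * \<bar>(x - y) $ b\<bar> \<le> \<bar>((G ^^ m) x - (G ^^ m) y) $ b\<bar>"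
    "vert ((G ^^ m) x - (G ^^ m) y) \<le> k * \<bar>((G ^^ m) x - (G ^^ m) y) $ b\<bar>" by auto
qed

lemma vert_contraction:
  assumes "4 * shear * \<bar>(x - y) $ b\<bar> \<le> vert (x - y)"
  shows "vert (G x - G y) \<le> 3 / 4 * vert (x - y)"
proof -
  define d v c where "d = \<bar>(x - y) $ b\<bar>" and "v = vert (x - y)" and "c = CARD('n) * tol"
  have d: "0 \<le> d" "4 * (shear * d) \<le> v" using assms by (auto simp: d_def v_def)
  have "1 * d \<le> shear * d" using d shear_ge_1 by (intro mult_right_mono) auto
  then have dv: "0 \<le> d + v" "d + v \<le> 2 * v" using d by auto
  have "c * (d + v) \<le> 1 / 128 * (2 * v)"
    using card_tol_le tol_pos dv by (intro mult_mono) (auto simp: c_def)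
  then show ?thesis
    using G_vert_diff[of x y] d dv by (simp add: d_def v_def c_def)
qed

text \<open>
  If the difference of the two points is in the wide cone, its base component would grow, but it
  is \<open>0\<close> at time \<open>m\<close>; hence either the points agree or the difference is outside the wide cone, where the
  fibre part contracts.
\<close>

lemma vert_pow_contraction:
  assumes "((G ^^ m) x - (G ^^ m) y) $ b = 0"
  shows "vert ((G ^^ m) x - (G ^^ m) y) \<le> (3 / 4) ^ m * vert (x - y)
    \<and> 4 * shear * \<bar>(x - y) $ b\<bar> \<le> vert (x - y)"
  using assms
proof (induction m arbitrary: x y)
  case 0
  then show ?case using vert_nonneg by simp
next
  case (Suc m)
  show ?case
  proof (cases "vert (x - y) \<le> 4 * shear * \<bar>(x - y) $ b\<bar>")
    case True
    have k: "1 \<le> 4 * shear" "4 * shear \<le> 4 * shear" using shear_ge_1 by auto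
    have "2 ^ Suc m * \<bar>(x - y) $ b\<bar> \<le> 0"
      using cone_pow_abs(1)[OF k True, of "Suc m"] Suc.prems by simp
    then have "(x - y) $ b = 0"
      by (metis abs_le_zero_iff mult_le_cancel_left_pos mult_zero_right zero_less_power
          zero_less_numeral)
    moreover have "vert ((G ^^ Suc m) x - (G ^^ Suc m) y) \<le> 0"
      using cone_pow_abs(2)[OF k True, of "Suc m"] Suc.prems by simp
    moreover have "0 \<le> (3 / 4) ^ Suc m * vert (x - y)" using vert_nonneg by simp
    ultimately show ?thesis
      using vert_nonneg[of "x - y"] by (metis order_trans abs_zero mult_zero_right)
  next
    case False
    have "vert ((G ^^ m) (G x) - (G ^^ m) (G y)) \<le> (3 / 4) ^ m * vert (G x - G y)"
      using Suc.IH[of "G x" "G y"] Suc.prems by (simp add: funpow_swap1)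
    also have "\<dots> \<le> (3 / 4) ^ m * (3 / 4 * vert (x - y))"
      using vert_contraction[of x y] False by (intro mult_left_mono) auto
    finally show ?thesis using False by (simp add: funpow_swap1)
  qed
qed

lemma continuous_on_E: "continuous_on S E"
proof (rule lipschitz_on_continuous_on)
  show "tol-lipschitz_on S E"
    using E_lipschitz tol_pos by (auto simp: lipschitz_on_def dist_norm)
qed

lemma continuous_on_G: "continuous_on S G"
proof -
  have "continuous_on S lift"
    using lift_has_derivative has_derivative_continuous
    by (metis continuous_at_imp_continuous_on)
  then show ?thesis unfolding G_def[abs_def] by (intro continuous_on_add continuous_on_E)
qed

lemma continuous_on_G_pow: "continuous_on S (G ^^ m)"
proof (induction m arbitrary: S)
  case 0
  then show ?case by (simp add: id_def[symmetric])
next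
  case (Suc m)
  then show ?case
    by (auto simp: o_def intro: continuous_on_compose2[OF continuous_on_G[of UNIV]])
qed

lemma surj_f: "surj f"
proof -
  have "\<exists>p. f p = proj v" for v
  proof -
    define w where "w i = (if i < CARD('n) then v $ inv e i else v $ b)" for i
    have we: "w (e j) = v $ j" for j
      using bij_e e_less by (simp add: w_def bij_betw_def inv_f_f)
    have wN: "w CARD('n) = v $ b" by (simp add: w_def)
    obtain s where s: "64 ^ CARD('n) * s - v $ b \<in> \<int>"
      and z: "\<And>i. i < CARD('n) \<Longrightarrow> \<exists>z\<in>\<int>. \<bar>64 ^ i * s - w i - z\<bar> \<le> 1 / 64"
      using digits[of "CARD('n)" w] unfolding wN by blast
    have "\<forall>j. \<exists>z\<in>\<int>. \<bar>64 ^ e j * s - v $ j - z\<bar> \<le> 1 / 64"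
      using z[OF e_less] we by simp
    then obtain z where z: "\<And>j. z j \<in> \<int>" "\<And>j. \<bar>64 ^ e j * s - v $ j - z j\<bar> \<le> 1 / 64"
      by metis
    \<comment> \<open>A fixed point of \<open>T\<close> solves \<open>lift x + E x = v + z\<close>, modulo integers in the
      base coordinate, with the equations for the fibre coordinates solved by \<open>arcsin\<close>.\<close>
    define t where "t x = s - E x $ b / 64 ^ CARD('n)" for x
    define r where "r j x = 8 * pi * (v $ j + z j - 64 ^ e j * t x - E x $ j)" for j x
    define T where "T x = (\<chi> j. if j = b then t x else arcsin (r j x) / (2 * pi))" for x
    have E_comp: "\<bar>E x $ j\<bar> \<le> tol" for x j
      using component_le_norm_cart[of "E x" j] E_le[of x] by simp
    have tol: "tol \<le> 1 / 128" using card_tol_le tol_le_card_tol by linarith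
    have r: "\<bar>r j x\<bar> \<le> 1" for j x
    proof -
      let ?q = "64 ^ e j * (E x $ b / 64 ^ CARD('n))"
      have "\<bar>?q\<bar> = (64 ^ e j / 64 ^ CARD('n)) * \<bar>E x $ b\<bar>"
        by (simp add: abs_mult)
      also have "\<dots> \<le> 1 * tol"
        using E_comp e_less[of j] tol_pos
        by (intro mult_mono) (auto simp: divide_le_eq_1 power_increasing)
      finally have q: "\<bar>?q\<bar> \<le> tol" by simp
      have "v $ j + z j - 64 ^ e j * t x - E x $ j
          = - (64 ^ e j * s - v $ j - z j) + ?q - E x $ j"
        by (simp add: t_def algebra_simps)
      then have "\<bar>v $ j + z j - 64 ^ e j * t x - E x $ j\<bar> \<le> 1 / 32"
        using q z(2)[of j] E_comp[of x j] tol by linarith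
      then have "\<bar>r j x\<bar> \<le> 8 * pi * (1 / 32)"
        unfolding r_def by (simp add: abs_mult)
      also have "\<dots> \<le> 1" using pi_less_4 by simp
      finally show ?thesis .
    qed
    have cE: "continuous_on UNIV (\<lambda>x. E x $ j)" for j
      by (intro continuous_intros continuous_on_E)
    have ct: "continuous_on UNIV t"
      unfolding t_def by (intro continuous_intros cE) simp
    have cr: "continuous_on UNIV (r j)" for j
      unfolding r_def by (intro continuous_intros cE ct)
    have cT: "continuous_on S T" for S
    proof -
      have "continuous_on UNIV T"
        unfolding T_def
      proof (rule continuous_on_vec_lambda)
        fix j
        have "continuous_on UNIV (\<lambda>x. arcsin (r j x))"
          by (rule continuous_on_arcsin[OF cr]) (use r[of j] in \<open>simp add: abs_le_iff minus_le_iff\<close>)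
        then show "continuous_on UNIV (\<lambda>x. if j = b then t x else arcsin (r j x) / (2 * pi))"
          using ct by (cases "j = b") (auto intro!: continuous_intros)
      qed
      then show ?thesis by (rule continuous_on_subset) simp
    qed
    have bound: "\<bar>T x $ j\<bar> \<le> \<bar>s\<bar> + 1" for x j
    proof (cases "j = b")
      case True
      have "\<bar>E x $ b\<bar> \<le> 1" using E_comp[of x b] tol by linarith
      also have "\<dots> \<le> 64 ^ CARD('n)" by simp
      finally have "\<bar>E x $ b / 64 ^ CARD('n)\<bar> \<le> 1" by (simp add: abs_divide)
      moreover have "T x $ j = s - E x $ b / 64 ^ CARD('n)" by (simp add: T_def t_def True)
      ultimately show ?thesis by linarith
    next
      case False
      have "\<bar>arcsin (r j x)\<bar> \<le> 2 * pi * 1"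
        using arcsin_bounded[of "r j x"] r[of j x] pi_gt_zero by (auto simp: abs_le_iff)
      then have "\<bar>arcsin (r j x) / (2 * pi)\<bar> \<le> 1" by (simp add: abs_divide)
      moreover have "T x $ j = arcsin (r j x) / (2 * pi)" by (simp add: T_def False)
      ultimately show ?thesis by linarith
    qed
    define S :: "(real ^ 'n) set" where "S = cbox (\<chi> i. - (\<bar>s\<bar> + 1)) (\<chi> i. \<bar>s\<bar> + 1)"
    have TS: "T x \<in> S" for x
    proof -
      have "- (\<bar>s\<bar> + 1) \<le> T x $ i \<and> T x $ i \<le> \<bar>s\<bar> + 1" for i
        using bound[of x i] by linarith
      then show ?thesis by (simp only: S_def mem_box_cart vec_lambda_beta) blast
    qed
    have S: "compact S" "convex S" "S \<noteq> {}" using TS by (auto simp: S_def)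
    obtain x where x: "T x = x" using brouwer[OF S cT] TS by (metis Pi_I)
    have "T x $ b = t x" by (simp add: T_def)
    then have xb: "x $ b = t x" by (simp only: x)
    have "G x $ j - v $ j \<in> \<int>" for j
    proof (cases "j = b")
      case True
      have "G x $ b = 64 ^ CARD('n) * s"
        by (simp add: G_def lift_base xb t_def right_diff_distrib)
      then show ?thesis using s True by simp
    next
      case False
      have "T x $ j = arcsin (r j x) / (2 * pi)" by (simp add: T_def False)
      then have "x $ j = arcsin (r j x) / (2 * pi)" by (simp only: x)
      then have "sin (2 * pi * x $ j) = r j x" using r[of j x] by (simp add: abs_le_iff)
      then have "G x $ j - v $ j = z j"
        by (simp add: G_def lift_fibre False xb) (simp add: r_def)
      then show ?thesis using z by simp
    qed
    then have "f (proj x) = proj v" by (simp add: f_proj proj_eq_iff)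
    then show ?thesis by blast
  qed
  then show ?thesis using proj_surj unfolding surj_def by metis
qed

end

section \<open>Orbits between arbitrary balls\<close>

lemma expanding_surj:
  fixes g :: "real \<Rightarrow> real"
  assumes "continuous_on UNIV g" "\<And>s t. s \<le> t \<Longrightarrow> t - s \<le> g t - g s"
  shows "\<exists>t. g t = y"
proof -
  let ?m = "\<bar>y - g 0\<bar>"
  have "\<exists>t\<ge>-?m. t \<le> ?m \<and> g t = y"
  proof (rule IVT')
    show "g (- ?m) \<le> y" using assms(2)[of "- ?m" 0] by linarith
    show "y \<le> g ?m" using assms(2)[of 0 ?m] by linarith
    show "continuous_on {- ?m..?m} g" using assms(1) continuous_on_subset by blast
  qed simp
  then show ?thesis by blast
qed

lemma ex_representative:
  fixes p :: "real ^ 'n::finite"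
  shows "\<exists>w. proj w = q \<and> (\<forall>i. 0 \<le> w $ i - p $ i \<and> w $ i - p $ i \<le> 1)"
proof -
  obtain x where x: "q = proj x" using proj_surj by metis
  define w where "w = (\<chi> i. p $ i + frac (x $ i - p $ i))"
  have "w $ i - x $ i = of_int (- \<lfloor>x $ i - p $ i\<rfloor>)" for i
    by (simp add: w_def frac_def)
  then have "proj w = proj x" unfolding proj_eq_iff by (metis Ints_of_int)
  moreover have "0 \<le> w $ i - p $ i \<and> w $ i - p $ i \<le> 1" for i
    by (simp add: w_def frac_lt_1 less_imp_le)
  ultimately show ?thesis using x by blast
qed

context perturbed_model
begin

lemma orbit_from_ball_to_ball:
  assumes "0 < \<epsilon>"
  shows "\<exists>x m. dist x u < \<epsilon> \<and> dist ((f ^^ m) (proj x)) q < \<epsilon>"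
proof -
  define n where "n = real CARD('n)"
  have n: "n \<ge> 0" by (simp add: n_def)
  obtain k where "(1 / 2) ^ k < \<epsilon> / (n + 3)"
    using real_arch_pow_inv[of "\<epsilon> / (n + 3)" "1 / 2"] assms n by auto
  then have k: "n + 3 < \<epsilon> * 2 ^ k" using n by (simp add: field_simps power_one_over)
  obtain l where "(3 / 4) ^ l < \<epsilon> / (2 * n + 3)"
    using real_arch_pow_inv[of "\<epsilon> / (2 * n + 3)" "3 / 4"] assms n by auto
  then have l: "(3 / 4) ^ l * (2 * n + 3) < \<epsilon>" using n by (simp add: field_simps)
  \<comment> \<open>The first \<open>k\<close> steps expand lengths \<open>\<epsilon>\<close> on the base line beyond \<open>n + 3\<close>; the last \<open>l\<close> steps
    contract the fibre distance to the orbit of \<open>w\<close>, which is at most \<open>2 * n + 3\<close>, below \<open>\<epsilon>\<close>.\<close>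
  define p where "p = (G ^^ k) u"
  obtain q' where q': "(f ^^ l) q' = q"
    using surj_fn[OF surj_f, of l] by (metis surjD)
  obtain w where w: "proj w = q'" "\<And>i. 0 \<le> w $ i - p $ i \<and> w $ i - p $ i \<le> 1"
    using ex_representative by metis
  have pw: "vert (p - w) \<le> n"
  proof -
    have "vert (p - w) \<le> (\<Sum>j\<in>-{b}. 1)"
      unfolding vert_def using w(2) by (intro sum_mono) (simp add: abs_le_iff)
    also have "\<dots> \<le> n" by (simp add: n_def card_mono)
    finally show ?thesis .
  qed
  define c where "c t = u + t *\<^sub>R axis b 1" for t :: real
  have c_diff: "(c t - c s) $ b = t - s" "vert (c t - c s) = 0" for s t
    by (auto simp: c_def vert_def axis_def algebra_simps)
  have cu: "(c t - u) $ b = t" "vert (c t - u) = 0" for t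
    using c_diff[of t 0] by (simp_all add: c_def)
  have one: "1 \<le> (1::real)" "1 \<le> 4 * shear" using shear_ge_1 by auto
  have "\<exists>t. (G ^^ (l + k)) (c t) $ b = (G ^^ l) w $ b"
  proof (rule expanding_surj)
    show "continuous_on UNIV (\<lambda>t. (G ^^ (l + k)) (c t) $ b)"
      unfolding c_def
      by (intro continuous_intros continuous_on_compose2[OF continuous_on_G_pow[of UNIV]]) auto
    fix s t :: real assume st: "s \<le> t"
    have "1 * (t - s) \<le> 2 ^ (l + k) * (t - s)" using st by (intro mult_right_mono) auto
    also have "\<dots> \<le> ((G ^^ (l + k)) (c t) - (G ^^ (l + k)) (c s)) $ b"
      using cone_pow[OF one, of "c t" "c s" "l + k"] st by (simp only: c_diff) simp
    finally show "t - s \<le> (G ^^ (l + k)) (c t) $ b - (G ^^ (l + k)) (c s) $ b" by simp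
  qed
  then obtain t where t: "(G ^^ (l + k)) (c t) $ b = (G ^^ l) w $ b" by blast
  define y where "y = (G ^^ k) (c t)"
  have y: "(G ^^ (l + k)) (c t) = (G ^^ l) y" by (simp add: y_def funpow_add)
  have contr: "vert ((G ^^ l) y - (G ^^ l) w) \<le> (3 / 4) ^ l * vert (y - w)"
    "4 * shear * \<bar>(y - w) $ b\<bar> \<le> vert (y - w)"
    using vert_pow_contraction[of l y w] t y by auto
  have yp: "2 ^ k * \<bar>t\<bar> \<le> \<bar>(y - p) $ b\<bar>" "vert (y - p) \<le> \<bar>(y - p) $ b\<bar>"
    using cone_pow_abs[OF one, of "c t" u k, unfolded cu] by (auto simp: y_def p_def)
  have "4 * 1 * \<bar>(y - w) $ b\<bar> \<le> 4 * shear * \<bar>(y - w) $ b\<bar>"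
    using shear_ge_1 by (intro mult_right_mono) auto
  then have h: "4 * \<bar>(y - w) $ b\<bar> \<le> vert (y - w)" using contr(2) by simp
  have ypb: "\<bar>(y - p) $ b\<bar> \<le> \<bar>(y - w) $ b\<bar> + 1"
    using w(2)[of b] unfolding vector_minus_component by linarith
  have "vert (y - w) \<le> vert (y - p) + vert (p - w)"
    using vert_triangle[of "y - p" "p - w"] by simp
  then have yw: "vert (y - w) \<le> 2 * n + 3" "\<bar>(y - p) $ b\<bar> \<le> n + 3"
    using h ypb yp(2) pw n by auto
  have "2 ^ k * \<bar>t\<bar> < 2 ^ k * \<epsilon>" using yp(1) yw(2) k mult.commute[of \<epsilon> "2 ^ k"] by linarith
  then have "\<bar>t\<bar> < \<epsilon>" by simp
  then have "dist (c t) u < \<epsilon>" by (simp add: c_def dist_norm)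
  moreover have "dist ((f ^^ (l + k)) (proj (c t))) q < \<epsilon>"
  proof -
    have "dist ((f ^^ (l + k)) (proj (c t))) q = dist (proj ((G ^^ l) y)) (proj ((G ^^ l) w))"
      by (simp add: f_pow_proj y flip: q' w(1))
    also have "\<dots> \<le> norm ((G ^^ l) y - (G ^^ l) w)"
      using dist_torus_le by (metis dist_norm)
    also have "\<dots> \<le> vert ((G ^^ l) y - (G ^^ l) w)"
      using norm_le_base_vert[of "(G ^^ l) y - (G ^^ l) w"] t y by simp
    also have "\<dots> \<le> (3 / 4) ^ l * (2 * n + 3)"
      by (rule order_trans[OF contr(1)]) (intro mult_left_mono yw(1), simp)
    finally show ?thesis using l by simp
  qed
  ultimately show ?thesis by blast
qed

end


section \<open>Robust transitivity\<close>

lemma C1_distD: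
  assumes "C1_endomorphism f" "C1_endomorphism g"
  shows "dist (f p) (g p) \<le> C1_dist f g"
    and "norm (torus_differential f p - torus_differential g p) \<le> C1_dist f g"
proof -
  have "dist (f p) (g p) \<le> (SUP p. dist (f p) (g p))"
    and "norm (torus_differential f p - torus_differential g p)
      \<le> (SUP p. norm (torus_differential f p - torus_differential g p))"
    by (intro cSUP_upper C1_bdd[OF assms] UNIV_I)+
  moreover have "0 \<le> dist (f p) (g p)"
    "0 \<le> norm (torus_differential f p - torus_differential g p)" by auto
  moreover have "C1_dist f g = (SUP p. dist (f p) (g p))
      + (SUP p. norm (torus_differential f p - torus_differential g p))"
    using assms by (simp add: C1_dist_def)
  ultimately show "dist (f p) (g p) \<le> C1_dist f g"
    "norm (torus_differential f p - torus_differential g p) \<le> C1_dist f g"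
    by linarith+
qed

text \<open>
  Since \<open>f\<close> is uniformly close to the model, the displacement \<open>E\<close> can be chosen pointwise as the
  short vector; it is locally the difference of two lifts and hence differentiable.
\<close>

lemma (in skew_model) perturbed_model_if_close:
  assumes f: "C1_endomorphism f" and close: "C1_dist torus_map f < tol"
  shows "\<exists>E. perturbed_model b e f E"
proof -
  note bounds = C1_distD[OF C1_endomorphism_torus_map f]
  have "\<exists>v. f (proj x) = proj (lift x + v) \<and> norm v < tol" for x
  proof -
    have "dist (torus_map (proj x)) (f (proj x)) < tol"
      using bounds(1) close by (rule order.strict_trans1)
    then obtain y where "proj y = f (proj x)" "dist (lift x) y < tol"
      using dist_torus_ltE torus_map_proj by metis
    then show ?thesis
      by (intro exI[of _ "y - lift x"]) (simp add: dist_norm norm_minus_commute)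
  qed
  then obtain E where E: "\<And>x. f (proj x) = proj (lift x + E x)" "\<And>x. norm (E x) < tol"
    by metis
  have tol: "tol < 1 / 2" using card_tol_le tol_le_card_tol by linarith
  have deriv: "(E has_derivative
      blinfun_apply (torus_differential f (proj x) - torus_differential torus_map (proj x))) (at x)" for x
  proof -
    obtain A where A: "has_torus_derivative f A (proj x)"
      using f unfolding C1_endomorphism_def by blast
    obtain H where H: "(H has_derivative blinfun_apply A) (at x)"
      and ev: "\<forall>\<^sub>F y in nhds x. f (proj y) = proj (H y)"
      using has_torus_derivative_at[OF A] by blast
    have Hx: "proj (lift x + E x) = proj (H x)"
      using eventually_nhds_x_imp_x[OF ev] E(1) by metis
    \<comment> \<open>The local lift \<open>H\<close>, moved by the integer vector that makes it agree at \<open>x\<close> with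
      \<open>lift + E\<close>.\<close>
    define K where "K y = H y + (lift x + E x - H x) - lift y" for y
    have "(K has_derivative (\<lambda>h. A h - lift_deriv x h)) (at x)"
      unfolding K_def by (auto intro!: derivative_eq_intros H lift_has_derivative)
    then have K: "(K has_derivative blinfun_apply (A - torus_differential torus_map (proj x))) (at x)"
      by (simp add: torus_differential_torus_map blinfun.diff_left[abs_def]
          bounded_linear_Blinfun_apply[OF bounded_linear_lift_deriv])
    have "isCont (\<lambda>y. norm (K y)) x"
      using K has_derivative_continuous by (intro continuous_intros) blast
    then have "((\<lambda>y. norm (K y)) \<longlongrightarrow> norm (K x)) (nhds x)"
      by (metis isCont_def tendsto_at_iff_tendsto_nhds)
    moreover have "norm (K x) < 1 / 2" using E(2)[of x] tol by (simp add: K_def)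
    ultimately have "\<forall>\<^sub>F y in nhds x. norm (K y) < 1 / 2" by (rule order_tendstoD)
    with ev have "\<forall>\<^sub>F y in nhds x. K y = E y"
    proof eventually_elim
      case (elim y)
      have "proj (lift y + K y) = proj (H y)"
      proof -
        have "lift y + K y = H y + (lift x + E x - H x)" by (simp add: K_def)
        then show ?thesis using proj_translate[OF Hx, of "H y"] by (simp only:)
      qed
      then have int: "\<forall>i. (lift y + K y) $ i - (lift y + E y) $ i \<in> \<int>"
        using elim(1) E(1) proj_eq_iff by metis
      have "norm (K y - E y) < 1"
        using norm_triangle_ineq4[of "K y" "E y"] elim(2) E(2)[of y] tol by linarith
      then have "\<bar>(K y - E y) $ i\<bar> < 1" for i
        using component_le_norm_cart[of "K y - E y" i] by linarith
      moreover have "(K y - E y) $ i \<in> \<int>" for i using int by simp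
      ultimately have "(K y - E y) $ i = 0" for i by (metis Ints_nonzero_abs_less1)
      then show ?case by (simp add: vec_eq_iff)
    qed
    moreover have "K x = E x" by (simp add: K_def)
    ultimately have "(E has_derivative blinfun_apply (A - torus_differential torus_map (proj x))) (at x)"
      using has_derivative_transform_eventually[OF K] by (simp add: eventually_nhds_conv_at)
    then show ?thesis using torus_differential_eq[OF A] by simp
  qed
  have "norm (E x - E y) \<le> tol * norm (x - y)" for x y
  proof (rule differentiable_bound[OF convex_UNIV deriv])
    show "onorm (blinfun_apply (torus_differential f (proj x) - torus_differential torus_map (proj x)))
        \<le> tol" for x
      using bounds(2)[of "proj x"] close by (simp add: norm_minus_commute flip: norm_blinfun.rep_eq)
  qed auto
  then have "perturbed_model b e f E"
    using E(1) less_imp_le[OF E(2)] by unfold_locales auto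
  then show ?thesis by blast
qed

text \<open>
  Baire's theorem is applied in Euclidean space, to the sets of points whose projection has an
  orbit that meets a given ball of a countable family.
\<close>

lemma transitive_map_torusI:
  fixes f :: "'n::finite torus \<Rightarrow> 'n torus"
  assumes cont: "continuous_on UNIV f"
    and hit: "\<And>u q \<epsilon>. 0 < \<epsilon> \<Longrightarrow> \<exists>x m. dist x u < \<epsilon> \<and> dist ((f ^^ m) (proj x)) q < \<epsilon>"
  shows "transitive_map f"
proof -
  have cont_pow: "continuous_on UNIV (\<lambda>x. (f ^^ m) (proj x))" for m
  proof (induction m)
    case 0
    then show ?case by (simp add: continuous_on_proj)
  next
    case (Suc m)
    then show ?case by (auto intro: continuous_on_compose2[OF cont])
  qed
  obtain D :: "(real ^ 'n) set" where D: "countable D" "\<And>X. open X \<Longrightarrow> X \<noteq> {} \<Longrightarrow> \<exists>d\<in>D. d \<in> X"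
    using countable_dense_exists by blast
  define V where "V d j = {x. \<exists>m. dist ((f ^^ m) (proj x)) (proj d) < 1 / real (Suc j)}"
    for d :: "real ^ 'n" and j
  have "open (V d j)" for d j
  proof -
    have "V d j = (\<Union>m. (\<lambda>x. (f ^^ m) (proj x)) -` ball (proj d) (1 / real (Suc j)))"
      by (auto simp: V_def dist_commute)
    then show ?thesis using open_vimage[OF open_ball cont_pow] by auto
  qed
  moreover have "closure (V d j) = UNIV" for d j
  proof -
    have "\<exists>x\<in>V d j. dist x u < \<epsilon>" if "0 < \<epsilon>" for u \<epsilon>
    proof -
      have "0 < min \<epsilon> (1 / real (Suc j))" using that by simp
      then obtain x m where "dist x u < min \<epsilon> (1 / real (Suc j))"
        "dist ((f ^^ m) (proj x)) (proj d) < min \<epsilon> (1 / real (Suc j))"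
        using hit by blast
      then show ?thesis by (intro bexI[of _ x]) (auto simp: V_def)
    qed
    then show ?thesis by (auto simp: closure_approachable)
  qed
  moreover have "countable ((\<lambda>(d, j). V d j) ` (D \<times> (UNIV :: nat set)))"
    using D(1) by simp
  ultimately have "UNIV \<subseteq> closure (\<Inter>((\<lambda>(d, j). V d j) ` (D \<times> UNIV)))"
    by (intro Baire) auto
  then obtain x where x: "x \<in> \<Inter>((\<lambda>(d, j). V d j) ` (D \<times> UNIV))"
    by (metis closure_empty ex_in_conv subset_empty UNIV_not_empty)
  have "closure {(f ^^ k) (proj x) |k. True} = UNIV"
  proof -
    have "\<exists>y\<in>{(f ^^ k) (proj x) |k. True}. dist y p < \<epsilon>" if \<epsilon>: "0 < \<epsilon>" for p \<epsilon>
    proof -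
      obtain z where z: "p = proj z" using proj_surj by metis
      obtain d where d: "d \<in> D" "dist z d < \<epsilon> / 2"
        using D(2)[of "ball z (\<epsilon> / 2)"] \<epsilon> by (auto simp: ball_eq_empty)
      obtain j where j: "1 / real (Suc j) < \<epsilon> / 2"
        using nat_approx_posE[of "\<epsilon> / 2"] \<epsilon> by auto
      have "x \<in> V d j" using x d(1) by auto
      then obtain m where m: "dist ((f ^^ m) (proj x)) (proj d) < 1 / real (Suc j)"
        by (auto simp: V_def)
      have "dist ((f ^^ m) (proj x)) p
          \<le> dist ((f ^^ m) (proj x)) (proj d) + dist (proj d) p"
        by (rule dist_triangle)
      also have "dist (proj d) p \<le> dist z d"
        using dist_torus_le[of d z] by (simp add: z dist_commute)
      finally have "dist ((f ^^ m) (proj x)) p < \<epsilon>" using m j d(2) by simp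
      then show ?thesis by blast
    qed
    then show ?thesis by (auto simp: closure_approachable)
  qed
  then show ?thesis unfolding transitive_map_def by blast
qed

lemma (in skew_model) C1_robustly_transitive_torus_map: "C1_robustly_transitive torus_map"
proof -
  interpret Metric_space "Collect C1_endomorphism" "C1_dist :: ('n torus \<Rightarrow> 'n torus) \<Rightarrow> _"
    by (rule Metric_space_C1)
  have "transitive_map g" if "g \<in> mball torus_map tol" for g
  proof -
    have g: "C1_endomorphism g" "C1_dist torus_map g < tol" using that by auto
    then obtain E where "perturbed_model b e g E" using perturbed_model_if_close by blast
    then show ?thesis
      using perturbed_model.orbit_from_ball_to_ball C1_endomorphism_continuous[OF g(1)]
      by (intro transitive_map_torusI) blast+
  qed
  then show ?thesis
    unfolding C1_robustly_transitive_def C1_topology_def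
    using C1_endomorphism_torus_map tol_pos by (intro exI[of _ "mball torus_map tol"]) auto
qed

section \<open>Persistent singularity\<close>

lemma continuous_on_det_blinfun:
  "continuous_on UNIV (\<lambda>A :: (real ^ 'n::finite) \<Rightarrow>\<^sub>L (real ^ 'n). det (matrix (blinfun_apply A)))"
  unfolding det_def matrix_def
  by (simp, intro continuous_intros blinfun.continuous_on)

lemma not_surj_if_det_eq_0:
  fixes g :: "real ^ 'n::finite \<Rightarrow> real ^ 'n"
  assumes "linear g" "det (matrix g) = 0"
  shows "\<not> surj g"
  using assms det_nz_iff_inj linear_surjective_imp_injective by blast

lemma (in skew_model) det_lift_deriv_0: "det (matrix (lift_deriv 0)) \<noteq> 0"
proof -
  have lin: "linear (lift_deriv 0)"
    using bounded_linear_lift_deriv bounded_linear.linear by blast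
  have "h = 0" if h: "lift_deriv 0 h = 0" for h
  proof -
    have "lift_deriv 0 h $ b = 0" using h by simp
    then have hb: "h $ b = 0" by (simp add: lift_deriv_def)
    have "h $ j = 0" if "j \<noteq> b" for j
    proof -
      have "lift_deriv 0 h $ j = 0" using h by simp
      then show ?thesis using that hb by (simp add: lift_deriv_def)
    qed
    then show ?thesis using hb by (metis vec_eq_iff zero_index)
  qed
  then have "inj (lift_deriv 0)" using linear_injective_0[OF lin] by blast
  then show ?thesis using det_nz_iff_inj[OF lin] by blast
qed

text \<open>
  Moving a fibre coordinate from \<open>0\<close> to \<open>1 / 2\<close> changes the sign of the cosine, and so composes the
  derivative with a reflection.
\<close>

lemma (in skew_model) det_lift_deriv_half:
  assumes c: "c \<noteq> b"
  shows "det (matrix (lift_deriv ((1 / 2) *\<^sub>R axis c 1))) = - det (matrix (lift_deriv 0))"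
proof -
  define S :: "real ^ 'n \<Rightarrow> real ^ 'n" where "S h = (\<chi> i. if i = c then - h $ i else h $ i)" for h
  have lin: "linear S"
    by (rule linearI) (auto simp: S_def vec_eq_iff)
  have mat: "matrix S $ i $ j = (if i = j then if i = c then -1 else 1 else 0)" for i j
    by (simp add: matrix_def S_def axis_def)
  have "det (matrix S) = (\<Prod>i\<in>UNIV. matrix S $ i $ i)"
    by (rule det_diagonal) (simp add: mat)
  also have "\<dots> = (\<Prod>i\<in>UNIV. if i = c then -1 else 1)" by (simp add: mat)
  also have "\<dots> = -1" by simp
  finally have det_S: "det (matrix S) = -1" .
  have "lift_deriv ((1 / 2) *\<^sub>R axis c 1) = lift_deriv 0 \<circ> S"
  proof
    fix h
    show "lift_deriv ((1 / 2) *\<^sub>R axis c 1) h = (lift_deriv 0 \<circ> S) h"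
      using c by (auto simp: lift_deriv_def S_def vec_eq_iff axis_def)
  qed
  then show ?thesis
    using matrix_compose[OF lin, of "lift_deriv 0"] bounded_linear_lift_deriv det_S
    by (simp add: det_mul bounded_linear.linear)
qed

lemma (in skew_model) persistently_singular_torus_map: "persistently_singular torus_map"
proof -
  interpret Metric_space "Collect C1_endomorphism" "C1_dist :: ('n torus \<Rightarrow> 'n torus) \<Rightarrow> _"
    by (rule Metric_space_C1)
  obtain c where c: "c \<noteq> b" using ex_fibre_index by blast
  define d where "d A = det (matrix (blinfun_apply A))" for A :: "(real ^ 'n) \<Rightarrow>\<^sub>L (real ^ 'n)"
  have cont_d: "continuous_on UNIV d"
    unfolding d_def by (rule continuous_on_det_blinfun)
  define x where "x t = t *\<^sub>R axis c (1::real)" for t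
  define D where "D t = torus_differential torus_map (proj (x t))" for t
  have D_eq: "d (D t) = det (matrix (lift_deriv (x t)))" for t
    by (simp add: d_def D_def torus_differential_torus_map
        bounded_linear_Blinfun_apply[OF bounded_linear_lift_deriv])
  have d0: "d (D 0) \<noteq> 0" using det_lift_deriv_0 by (simp add: D_eq x_def)
  have d_half: "d (D (1 / 2)) = - d (D 0)"
    using det_lift_deriv_half[OF c] by (simp only: D_eq x_def) simp
  have "\<exists>\<epsilon>>0. \<forall>A. norm (D t - A) < \<epsilon> \<longrightarrow> \<bar>d A - d (D t)\<bar> < \<bar>d (D 0)\<bar>" for t
  proof -
    have "isCont d (D t)" using cont_d by (simp add: continuous_on_eq_continuous_at)
    then show ?thesis
      unfolding continuous_at_eps_delta dist_norm
      using d0 by (metis norm_minus_commute real_norm_def zero_less_abs_iff)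
  qed
  then obtain r where r: "\<And>t. 0 < r t"
    "\<And>t A. norm (D t - A) < r t \<Longrightarrow> \<bar>d A - d (D t)\<bar> < \<bar>d (D 0)\<bar>"
    by metis
  have "critical_points g \<noteq> {}" if "g \<in> mball torus_map (min (r 0) (r (1 / 2)))" for g
  proof -
    have g: "C1_endomorphism g" "C1_dist torus_map g < r 0" "C1_dist torus_map g < r (1 / 2)"
      using that by auto
    define a where "a t = d (torus_differential g (proj (x t)))" for t
    have close: "norm (D t - torus_differential g (proj (x t))) \<le> C1_dist torus_map g" for t
      unfolding D_def by (rule C1_distD(2)[OF C1_endomorphism_torus_map g(1)])
    have a: "\<bar>a 0 - d (D 0)\<bar> < \<bar>d (D 0)\<bar>" "\<bar>a (1 / 2) + d (D 0)\<bar> < \<bar>d (D 0)\<bar>"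
      using r(2)[OF order.strict_trans1[OF close g(2)]]
        r(2)[OF order.strict_trans1[OF close g(3)]] d_half
      by (simp_all add: a_def)
    have "continuous_on UNIV (\<lambda>t. proj (x t))"
      unfolding x_def
      by (intro continuous_on_compose2[OF continuous_on_proj[of UNIV]] continuous_intros) auto
    then have "continuous_on UNIV (\<lambda>t. torus_differential g (proj (x t)))"
      using g(1) unfolding C1_endomorphism_def by (auto intro: continuous_on_compose2)
    then have cont_a: "continuous_on UNIV a"
      unfolding a_def by (auto intro: continuous_on_compose2[OF cont_d])
    have "\<exists>t. a t = 0"
    proof (cases "d (D 0) > 0")
      case True
      then have "a 0 \<ge> 0" "a (1 / 2) \<le> 0" using a by auto
      then show ?thesis
        using IVT2'[of a "1 / 2" 0 0] cont_a continuous_on_subset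
        by (metis top_greatest zero_le_divide_1_iff zero_le_numeral)
    next
      case False
      then have "a 0 \<le> 0" "a (1 / 2) \<ge> 0" using a by auto
      then show ?thesis
        using IVT'[of a 0 0 "1 / 2"] cont_a continuous_on_subset
        by (metis top_greatest zero_le_divide_1_iff zero_le_numeral)
    qed
    then obtain t where "a t = 0" by blast
    then have "proj (x t) \<in> critical_points g"
      using not_surj_if_det_eq_0[OF bounded_linear.linear[OF blinfun.bounded_linear_right]]
      by (simp add: critical_points_def a_def d_def)
    then show ?thesis by blast
  qed
  then show ?thesis
    unfolding persistently_singular_def C1_topology_def
    using C1_endomorphism_torus_map r(1)
    by (intro exI[of _ "mball torus_map (min (r 0) (r (1 / 2)))"]) auto
qed

section \<open>Existence\<close>

theorem theorem1p1:
  assumes "CARD('n::finite) \<ge> 2"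
  shows "\<exists>F :: 'n torus \<Rightarrow> 'n torus.
    C1_endomorphism F \<and> persistently_singular F \<and> C1_robustly_transitive F"
proof -
  obtain e :: "'n \<Rightarrow> nat" where "bij_betw e UNIV {0..<CARD('n)}"
    using ex_bij_betw_finite_nat[of "UNIV :: 'n set"] by auto
  moreover obtain b :: 'n where "b \<in> UNIV" by blast
  ultimately interpret skew_model b e
    using assms by unfold_locales (simp_all add: lessThan_atLeast0)
  show ?thesis
    using C1_endomorphism_torus_map persistently_singular_torus_map C1_robustly_transitive_torus_map by blast
qed

end
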